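(* Let $C$ be given by spectral duality data as described in the context, with orbit directors $\mathbf d_O$, normal directions $\mathbf n_\nu$, orientation field $\psi(\gamma)$ and response span $V$. Then: (i) Every normal direction decomposes as $\mathbf n_\nu=\sum_O w^{(O)}_\nu\,\mathbf d_O$ (sum over all orbits $O$), with $w^{(O)}_\nu=[\mathbf n_\nu]_{z_O}/\sqrt{\kappa(z_O)}$, each $\mathbf d_O$ being supported on its own orbit. In particular every $\mathbf n_\nu$ vanishes at every neutral site. (ii) The coefficient matrix $(w^{(O)}_\nu)_{\nu,O}$ (rows indexed by $\nu=1,\dots,N$, columns by the orbits) has full column rank $n_{\mathrm{pair}}$; in particular, for every orbit $O$ there is $\nu$ with $w^{(O)}_\nu\neq0$. (iii) $V=\bigoplus_O\mathbb R\,\mathbf d_O$, so that $r:=\dim V=n_{\mathrm{pair}}$, and for all $\gamma\in(0,1)$ $$\psi(\gamma)=\sum_O\varphi_O(\gamma)\,\mathbf d_O,\qquad \varphi_O(\gamma):=\sum_{\nu=1}^N f_\nu(\gamma)\,w^{(O)}_\nu .$$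
   Context: Let $m\ge2$ and let $Z=\{z_1,\dots,z_m\}$ be a set of $m$ distinct sites; coordinates of $\mathbb R^m$ are indexed by $Z$, and $\langle\cdot,\cdot\rangle$ is the standard pairing. $\Delta_{m-1}=\{\pi\in\mathbb R^m:\pi_z\ge0,\ \sum_z\pi_z=1\}$. Spectral duality data consist of: - an integer $N$, real-analytic functions $f_1,\dots,f_N:(0,1)\to\mathbb R$, linearly independent as functions on $(0,1)$, and real coefficients $A_\nu(z)$ ($1\le\nu\le N$, $z\in Z$) such that the matrix $(A_\nu(z_i))\in\mathbb R^{N\times m}$ has full column rank $m\le N$; - an involution $\sigma:Z\to Z$ ($\sigma^2=\mathrm{id}$) with at least one non-trivial pair $z\ne\sigma(z)$, and weights $\kappa(z)>0$ independent of $\nu$; one sets $B_\nu(z):=\kappa(z)A_\nu(\sigma(z))$; - a constant $K>0$ with $\kappa(z)\kappa(\sigma(z))=K$ for all $z\in Z$. With $u(z;\gamma)=\sum_\nu f_\nu(\gamma)A_\nu(z)$ and $s(z;\gamma)=\sum_\nu f_\nu(\gamma)(A_\nu(z)+B_\nu(z))$, it is assumed that $\sum_z\pi_z s(z;\gamma)>0$ on all of $\Delta_{m-1}\times(0,1)$, and $C(\pi,\gamma)=\sum_z\pi_zu(z;\gamma)/\sum_z\pi_zs(z;\gamma)$. Put $C^\ast=1/(1+\sqrt K)$. An orbit is a pair $O=\{z,\sigma(z)\}$ with $\sigma(z)\ne z$; a neutral site is a fixed point of $\sigma$; $n_{\mathrm{pair}}$ is the number of orbits. In each orbit $O$ a representative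 $z_O$ is fixed. The orbit director $\mathbf d_O\in\mathbb R^m$ has component $\sqrt{\kappa(z_O)}$ at $z_O$, $-\sqrt{\kappa(\sigma(z_O))}$ at $\sigma(z_O)$, and $0$ elsewhere. The normal directions $\mathbf n_\nu\in\mathbb R^m$ are $[\mathbf n_\nu]_z=(1-C^\ast)A_\nu(z)-C^\ast\kappa(z)A_\nu(\sigma(z))$. The orientation field is $\psi_z(\gamma)=u(z;\gamma)-C^\ast s(z;\gamma)$, and $V=\operatorname{span}\{\psi(\gamma):\gamma\in(0,1)\}\subseteq\mathbb R^m$. *)

theory Defs
  imports "HOL-Analysis.Analysis"
begin

definition real_analytic_on :: "(real \<Rightarrow> real) \<Rightarrow> real set \<Rightarrow> bool" where
  "real_analytic_on f S \<longleftrightarrow>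
     (\<forall>x\<in>S. \<exists>a. \<exists>e>0. \<forall>y. \<bar>y - x\<bar> < e \<longrightarrow> (\<lambda>k. a k * (y - x) ^ k) sums f y)"

definition lin_indep_functions_on :: "real set \<Rightarrow> ('n::finite \<Rightarrow> real \<Rightarrow> real) \<Rightarrow> bool" where
  "lin_indep_functions_on S f \<longleftrightarrow>
     (\<forall>c :: 'n \<Rightarrow> real. (\<forall>x\<in>S. (\<Sum>\<nu>\<in>UNIV. c \<nu> * f \<nu> x) = 0) \<longrightarrow> (\<forall>\<nu>. c \<nu> = 0))"

definition prob_simplex :: "(real ^ 'z) set" where
  "prob_simplex = {p. (\<forall>z. 0 \<le> p $ z) \<and> (\<Sum>z\<in>UNIV. p $ z) = 1}"

definition internal_direct_sum :: "'i set \<Rightarrow> ('i \<Rightarrow> 'v::real_vector set) \<Rightarrow> 'v set \<Rightarrow> bool" where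
  "internal_direct_sum I W V \<longleftrightarrow>
     finite I \<and> (\<forall>i\<in>I. subspace (W i)) \<and>
     V = {\<Sum>i\<in>I. x i | x. \<forall>i\<in>I. x i \<in> W i} \<and>
     (\<forall>x. (\<forall>i\<in>I. x i \<in> W i) \<and> (\<Sum>i\<in>I. x i) = 0 \<longrightarrow> (\<forall>i\<in>I. x i = 0))"

text \<open>The library's \<open>rank\<close> needs the columns to be indexed by a whole type; here the column
  index ranges over a finite set \<open>J\<close>. As in the library's lemma \<open>column_rank_def\<close>, the rank is the
  dimension of the set of columns.\<close>

definition column_rank_on :: "'j set \<Rightarrow> ('n::finite \<Rightarrow> 'j \<Rightarrow> real) \<Rightarrow> nat" where
  "column_rank_on J w = dim ((\<lambda>j. (\<chi> \<nu>. w \<nu> j) :: real ^ 'n) ` J)"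

text \<open>The sites are the elements of the finite type \<open>'z\<close> (so \<open>m = CARD('z)\<close>), and the index
  \<open>\<nu>\<close> ranges over the finite type \<open>'n\<close> (so \<open>N = CARD('n)\<close>). The coefficient \<open>A\<^sub>\<nu>(z)\<close> is
  \<open>A $ \<nu> $ z\<close>, so \<open>A\<close> has a row for each \<open>\<nu>\<close> and a column for each site. The functions
  \<open>f \<nu>\<close> matter only on the open interval \<open>(0,1)\<close>.\<close>

definition B_coeff ::
  "real ^ 'z ^ 'n \<Rightarrow> ('z \<Rightarrow> 'z) \<Rightarrow> ('z \<Rightarrow> real) \<Rightarrow> 'n \<Rightarrow> 'z \<Rightarrow> real" where
  "B_coeff A \<sigma> \<kappa> \<nu> z = \<kappa> z * A $ \<nu> $ \<sigma> z"

definition u_fun ::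
  "('n::finite \<Rightarrow> real \<Rightarrow> real) \<Rightarrow> real ^ 'z ^ 'n \<Rightarrow> 'z \<Rightarrow> real \<Rightarrow> real" where
  "u_fun f A z \<gamma> = (\<Sum>\<nu>\<in>UNIV. f \<nu> \<gamma> * A $ \<nu> $ z)"

definition s_fun ::
  "('n::finite \<Rightarrow> real \<Rightarrow> real) \<Rightarrow> real ^ 'z ^ 'n \<Rightarrow> ('z \<Rightarrow> 'z) \<Rightarrow> ('z \<Rightarrow> real) \<Rightarrow> 'z \<Rightarrow> real \<Rightarrow> real" where
  "s_fun f A \<sigma> \<kappa> z \<gamma> = (\<Sum>\<nu>\<in>UNIV. f \<nu> \<gamma> * (A $ \<nu> $ z + B_coeff A \<sigma> \<kappa> \<nu> z))"

locale spectral_duality_data =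
  fixes f :: "'n::finite \<Rightarrow> real \<Rightarrow> real"
    and A :: "real ^ 'z::finite ^ 'n"
    and \<sigma> :: "'z \<Rightarrow> 'z"
    and \<kappa> :: "'z \<Rightarrow> real"
    and K :: real
  assumes two_le_sites: "2 \<le> CARD('z)"
    and analytic: "\<And>\<nu>. real_analytic_on (f \<nu>) {0<..<1}"
    and lin_indep: "lin_indep_functions_on {0<..<1} f"
    and sites_le: "CARD('z) \<le> CARD('n)"
    and full_column_rank: "rank A = CARD('z)"
    and involution: "\<And>z. \<sigma> (\<sigma> z) = z"
    and nontrivial_pair: "\<exists>z. \<sigma> z \<noteq> z"
    and weight_pos: "\<And>z. 0 < \<kappa> z"
    and K_pos: "0 < K"
    and weight_prod: "\<And>z. \<kappa> z * \<kappa> (\<sigma> z) = K"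
    and s_pos: "\<And>p \<gamma>. \<lbrakk>p \<in> prob_simplex; \<gamma> \<in> {0<..<1}\<rbrakk> \<Longrightarrow>
                  0 < (\<Sum>z\<in>UNIV. p $ z * s_fun f A \<sigma> \<kappa> z \<gamma>)"

definition response ::
  "('n::finite \<Rightarrow> real \<Rightarrow> real) \<Rightarrow> real ^ 'z ^ 'n \<Rightarrow> ('z \<Rightarrow> 'z) \<Rightarrow> ('z \<Rightarrow> real)
     \<Rightarrow> real ^ 'z \<Rightarrow> real \<Rightarrow> real" where
  "response f A \<sigma> \<kappa> p \<gamma> =
     (\<Sum>z\<in>UNIV. p $ z * u_fun f A z \<gamma>) / (\<Sum>z\<in>UNIV. p $ z * s_fun f A \<sigma> \<kappa> z \<gamma>)"

definition C_star :: "real \<Rightarrow> real" where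
  "C_star K = 1 / (1 + sqrt K)"

definition pair_orbits :: "('z \<Rightarrow> 'z) \<Rightarrow> 'z set set" where
  "pair_orbits \<sigma> = {{z, \<sigma> z} | z. \<sigma> z \<noteq> z}"

definition n_pair :: "('z \<Rightarrow> 'z) \<Rightarrow> nat" where
  "n_pair \<sigma> = card (pair_orbits \<sigma>)"

text \<open>Below, \<open>rep\<close> is the choice of a representative of each orbit.\<close>

definition orbit_director ::
  "('z \<Rightarrow> 'z) \<Rightarrow> ('z \<Rightarrow> real) \<Rightarrow> ('z set \<Rightarrow> 'z) \<Rightarrow> 'z set \<Rightarrow> real ^ 'z" where
  "orbit_director \<sigma> \<kappa> rep \<omega> =
     (\<chi> z. if z = rep \<omega> then sqrt (\<kappa> (rep \<omega>))
           else if z = \<sigma> (rep \<omega>) then - sqrt (\<kappa> (\<sigma> (rep \<omega>)))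
           else 0)"

definition normal_direction ::
  "real ^ 'z ^ 'n \<Rightarrow> ('z \<Rightarrow> 'z) \<Rightarrow> ('z \<Rightarrow> real) \<Rightarrow> real \<Rightarrow> 'n \<Rightarrow> real ^ 'z" where
  "normal_direction A \<sigma> \<kappa> K \<nu> =
     (\<chi> z. (1 - C_star K) * A $ \<nu> $ z - C_star K * \<kappa> z * A $ \<nu> $ \<sigma> z)"

definition orientation_field ::
  "('n::finite \<Rightarrow> real \<Rightarrow> real) \<Rightarrow> real ^ 'z ^ 'n \<Rightarrow> ('z \<Rightarrow> 'z) \<Rightarrow> ('z \<Rightarrow> real) \<Rightarrow> real
     \<Rightarrow> real \<Rightarrow> real ^ 'z" where
  "orientation_field f A \<sigma> \<kappa> K \<gamma> =
     (\<chi> z. u_fun f A z \<gamma> - C_star K * s_fun f A \<sigma> \<kappa> z \<gamma>)"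

definition response_span ::
  "('n::finite \<Rightarrow> real \<Rightarrow> real) \<Rightarrow> real ^ 'z ^ 'n \<Rightarrow> ('z \<Rightarrow> 'z) \<Rightarrow> ('z \<Rightarrow> real) \<Rightarrow> real
     \<Rightarrow> (real ^ 'z) set" where
  "response_span f A \<sigma> \<kappa> K = span (orientation_field f A \<sigma> \<kappa> K ` {0<..<1})"

definition orbit_coeff ::
  "real ^ 'z ^ 'n \<Rightarrow> ('z \<Rightarrow> 'z) \<Rightarrow> ('z \<Rightarrow> real) \<Rightarrow> real \<Rightarrow> ('z set \<Rightarrow> 'z) \<Rightarrow> 'n \<Rightarrow> 'z set \<Rightarrow> real" where
  "orbit_coeff A \<sigma> \<kappa> K rep \<nu> \<omega> =
     normal_direction A \<sigma> \<kappa> K \<nu> $ rep \<omega> / sqrt (\<kappa> (rep \<omega>))"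

definition orbit_profile ::
  "('n::finite \<Rightarrow> real \<Rightarrow> real) \<Rightarrow> real ^ 'z ^ 'n \<Rightarrow> ('z \<Rightarrow> 'z) \<Rightarrow> ('z \<Rightarrow> real) \<Rightarrow> real
     \<Rightarrow> ('z set \<Rightarrow> 'z) \<Rightarrow> 'z set \<Rightarrow> real \<Rightarrow> real" where
  "orbit_profile f A \<sigma> \<kappa> K rep \<omega> \<gamma> =
     (\<Sum>\<nu>\<in>UNIV. f \<nu> \<gamma> * orbit_coeff A \<sigma> \<kappa> K rep \<nu> \<omega>)"

end

theory Submission
  imports Defs
begin

text \<open>Writing \<open>e \<omega>\<close> for the orbit director built from the weights \<open>\<kappa> \<circ> \<sigma>\<close>, the identity
  \<open>\<surd>\<kappa>(z) \<surd>\<kappa>(\<sigma> z) = \<surd>K\<close> makes the rescaled normal direction \<open>z \<mapsto> n\<^sub>\<nu>(z) / \<surd>\<kappa>(z)\<close> change sign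
  under \<open>\<sigma>\<close>, which gives (i), and shows that the \<open>\<omega>\<close>-th column of the coefficient matrix is
  \<open>C\<^sup>* A e \<omega>\<close>. As \<open>A\<close> is injective and the \<open>e \<omega>\<close> have disjoint supports, (ii) follows. A vector
  orthogonal to all \<open>\<psi>(\<gamma>)\<close> is orthogonal to all \<open>n\<^sub>\<nu>\<close> by linear independence of the \<open>f\<^sub>\<nu>\<close>, hence
  to all orbit directors by (ii); this gives (iii).\<close>

section \<open>Linear algebra of finite families\<close>

lemma independent_family:
  fixes v :: "'i \<Rightarrow> 'v::real_vector"
  assumes "finite I"
    and zero: "\<And>a. (\<Sum>i\<in>I. a i *\<^sub>R v i) = 0 \<Longrightarrow> \<forall>i\<in>I. a i = 0"
  shows "inj_on v I" "independent (v ` I)"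
proof -
  show inj: "inj_on v I"
  proof (rule inj_onI, rule ccontr)
    fix i j assume ij: "i \<in> I" "j \<in> I" "v i = v j" "i \<noteq> j"
    \<comment> \<open>If \<open>v i = v j\<close>, the coefficients 1 at \<open>i\<close> and -1 at
      \<open>j\<close> give a non-trivial relation.\<close>
    define a :: "'i \<Rightarrow> real" where "a k = (if k = i then 1 else 0) - (if k = j then 1 else 0)" for k
    have "(\<Sum>k\<in>I. a k *\<^sub>R v k) =
        (\<Sum>k\<in>I. if k = i then v k else 0) - (\<Sum>k\<in>I. if k = j then v k else 0)"
      unfolding sum_subtractf[symmetric] by (intro sum.cong) (auto simp: a_def)
    also have "\<dots> = 0" using ij \<open>finite I\<close> by simp
    finally have "a i = 0" using zero ij by blast
    then show False using ij by (simp add: a_def)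
  qed
  show "independent (v ` I)"
  proof (rule independent_if_scalars_zero)
    show "finite (v ` I)" using \<open>finite I\<close> by simp
    fix g x assume g: "(\<Sum>x\<in>v ` I. g x *\<^sub>R x) = 0" and x: "x \<in> v ` I"
    have "(\<Sum>i\<in>I. g (v i) *\<^sub>R v i) = 0" using g by (simp add: sum.reindex[OF inj])
    then show "g x = 0" using zero[of "\<lambda>i. g (v i)"] x by blast
  qed
qed

text \<open>Split \<open>v\<close> into \<open>a\<close> in the span and \<open>b\<close> orthogonal
  to it. Then \<open>b\<close> is orthogonal to \<open>v\<close> by hypothesis and to
  \<open>a\<close>, hence to itself.\<close>

lemma in_span_if_orthogonal:
  fixes v :: "'a::euclidean_space"
  assumes "\<And>y. (\<And>x. x \<in> S \<Longrightarrow> y \<bullet> x = 0) \<Longrightarrow> y \<bullet> v = 0"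
  shows "v \<in> span S"
proof -
  obtain a b where a: "a \<in> span S" and b: "\<And>w. w \<in> span S \<Longrightarrow> orthogonal b w" and v: "v = a + b"
    using orthogonal_subspace_decomp_exists by blast
  have "b \<bullet> v = 0" using assms b by (simp add: orthogonal_def span_base)
  moreover have "b \<bullet> a = 0" using a b by (simp add: orthogonal_def)
  ultimately have "b = 0" by (simp add: v inner_add_right)
  then show ?thesis using a v by simp
qed

lemma internal_direct_sum_lines:
  fixes v :: "'i \<Rightarrow> 'v::real_vector"
  assumes fin: "finite I"
    and zero: "\<And>a. (\<Sum>i\<in>I. a i *\<^sub>R v i) = 0 \<Longrightarrow> \<forall>i\<in>I. a i = 0"
  shows "internal_direct_sum I (\<lambda>i. span {v i}) (span (v ` I))"
proof -
  have scalars: "\<exists>a. \<forall>i\<in>I. x i = a i *\<^sub>R v i" if "\<forall>i\<in>I. x i \<in> span {v i}" for x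
    using that by (intro bchoice) (auto simp: span_singleton)
  have "span (v ` I) \<subseteq> {\<Sum>i\<in>I. x i | x. \<forall>i\<in>I. x i \<in> span {v i}}"
  proof
    fix y assume "y \<in> span (v ` I)"
    \<comment> \<open>A combination over the image of \<open>v\<close> becomes one over
      \<open>I\<close> because \<open>v\<close> is injective on \<open>I\<close>.\<close>
    then obtain u where "y = (\<Sum>i\<in>I. u (v i) *\<^sub>R v i)"
      using fin by (auto simp: span_finite sum.reindex[OF independent_family(1)[OF fin zero]])
    then show "y \<in> {\<Sum>i\<in>I. x i | x. \<forall>i\<in>I. x i \<in> span {v i}}"
      by (intro CollectI exI[of _ "\<lambda>i. u (v i) *\<^sub>R v i"]) (auto simp: span_scale span_base)
  qed
  moreover have "(\<Sum>i\<in>I. x i) \<in> span (v ` I)" if "\<forall>i\<in>I. x i \<in> span {v i}" for x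
  proof (rule span_sum)
    fix i assume "i \<in> I"
    then have "span {v i} \<subseteq> span (v ` I)" by (intro span_mono) auto
    with that \<open>i \<in> I\<close> show "x i \<in> span (v ` I)" by blast
  qed
  moreover have "\<forall>i\<in>I. x i = 0" if "\<forall>i\<in>I. x i \<in> span {v i}" "(\<Sum>i\<in>I. x i) = 0" for x
  proof -
    obtain a where a: "\<forall>i\<in>I. x i = a i *\<^sub>R v i" using scalars \<open>\<forall>i\<in>I. x i \<in> span {v i}\<close> by blast
    then have "(\<Sum>i\<in>I. a i *\<^sub>R v i) = 0" using \<open>(\<Sum>i\<in>I. x i) = 0\<close> by simp
    then show ?thesis using a zero by auto
  qed
  ultimately show ?thesis
    unfolding internal_direct_sum_def using fin by auto
qed

section \<open>Orbits of an involution and their directors\<close>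

locale orbit_representatives =
  fixes \<sigma> :: "'z::finite \<Rightarrow> 'z" and rep :: "'z set \<Rightarrow> 'z"
  assumes involution': "\<sigma> (\<sigma> z) = z"
    and rep: "\<omega> \<in> pair_orbits \<sigma> \<Longrightarrow> rep \<omega> \<in> \<omega>"
begin

lemma finite_pair_orbits: "finite (pair_orbits \<sigma>)"
  by simp

lemma pair_orbits_eq:
  assumes "\<omega> \<in> pair_orbits \<sigma>" "z \<in> \<omega>"
  shows "\<omega> = {z, \<sigma> z}" "\<sigma> z \<noteq> z"
  using assms by (auto simp: pair_orbits_def involution')

lemma orbit_director_support:
  assumes "\<omega> \<in> pair_orbits \<sigma>" "z \<notin> \<omega>"
  shows "orbit_director \<sigma> \<kappa> rep \<omega> $ z = 0"
  using assms(2) rep[OF assms(1)] pair_orbits_eq(1)[OF assms(1) rep[OF assms(1)]]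
  by (auto simp: orbit_director_def)

text \<open>Any point of an orbit determines it, so \<open>z\<close> lies in no other orbit and the
  remaining directors vanish there.\<close>

lemma orbit_director_sum_component:
  assumes "\<omega> \<in> pair_orbits \<sigma>" "z \<in> \<omega>"
  shows "(\<Sum>\<omega>'\<in>pair_orbits \<sigma>. a \<omega>' *\<^sub>R orbit_director \<sigma> \<kappa> rep \<omega>') $ z =
    a \<omega> * orbit_director \<sigma> \<kappa> rep \<omega> $ z"
proof -
  have "orbit_director \<sigma> \<kappa> rep \<omega>' $ z = 0" if "\<omega>' \<in> pair_orbits \<sigma>" "\<omega>' \<noteq> \<omega>" for \<omega>'
    using that assms pair_orbits_eq(1) by (intro orbit_director_support) blast+
  then show ?thesis
    using assms(1) by (simp add: sum.remove[OF finite_pair_orbits])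
qed

text \<open>At \<open>rep \<omega>\<close> only the summand of \<open>\<omega>\<close> survives, and
  its director has a positive entry there. The weights are left arbitrary, since the lemma serves
  both \<open>\<kappa>\<close> and \<open>\<kappa> \<circ> \<sigma>\<close>.\<close>

lemma orbit_directors_zero:
  assumes "\<And>z. 0 < \<kappa> z"
    and "(\<Sum>\<omega>\<in>pair_orbits \<sigma>. a \<omega> *\<^sub>R orbit_director \<sigma> \<kappa> rep \<omega>) = 0"
  shows "\<forall>\<omega>\<in>pair_orbits \<sigma>. a \<omega> = 0"
proof
  fix \<omega> assume "\<omega> \<in> pair_orbits \<sigma>"
  then have "a \<omega> * orbit_director \<sigma> \<kappa> rep \<omega> $ rep \<omega> = 0"
    using assms(2) rep by (simp flip: orbit_director_sum_component)
  then show "a \<omega> = 0"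
    using assms(1)[of "rep \<omega>"] by (simp add: orbit_director_def)
qed

end

section \<open>Normal directions and the coefficient matrix\<close>

locale represented_spectral_duality_data =
  spectral_duality_data f A \<sigma> \<kappa> K + orbit_representatives \<sigma> rep
  for f :: "'n::finite \<Rightarrow> real \<Rightarrow> real" and A :: "real ^ 'z::finite ^ 'n" and \<sigma> \<kappa> K rep
begin

lemma C_star_pos: "0 < C_star K"
  using K_pos by (simp add: C_star_def add_pos_nonneg)

text \<open>The value \<open>C_star K\<close> is the one for which
  \<open>1 - C_star K = C_star K * sqrt K\<close>. Splitting \<open>sqrt K\<close> over
  \<open>z\<close> and \<open>\<sigma> z\<close> lets \<open>sqrt (\<kappa> z)\<close> factor out,
  and the remaining bracket changes sign when \<open>z\<close> and \<open>\<sigma> z\<close> are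
  exchanged.\<close>

lemma normal_direction_eq:
  "normal_direction A \<sigma> \<kappa> K \<nu> $ z =
    C_star K * sqrt (\<kappa> z) * (sqrt (\<kappa> (\<sigma> z)) * A $ \<nu> $ z - sqrt (\<kappa> z) * A $ \<nu> $ \<sigma> z)"
proof -
  have "1 + sqrt K > 0" using K_pos by (simp add: add_pos_nonneg)
  then have "1 - C_star K = C_star K * sqrt K"
    by (simp add: C_star_def field_simps)
  moreover have "sqrt K = sqrt (\<kappa> z) * sqrt (\<kappa> (\<sigma> z))"
    by (simp add: weight_prod flip: real_sqrt_mult)
  moreover have "sqrt (\<kappa> z) * sqrt (\<kappa> z) = \<kappa> z"
    using weight_pos[of z] by simp
  ultimately have "1 - C_star K = C_star K * sqrt (\<kappa> z) * sqrt (\<kappa> (\<sigma> z))"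
    and "\<kappa> z = sqrt (\<kappa> z) * sqrt (\<kappa> z)" by simp_all
  then have "normal_direction A \<sigma> \<kappa> K \<nu> $ z =
      (C_star K * sqrt (\<kappa> z) * sqrt (\<kappa> (\<sigma> z))) * A $ \<nu> $ z -
      C_star K * (sqrt (\<kappa> z) * sqrt (\<kappa> z)) * A $ \<nu> $ \<sigma> z"
    unfolding normal_direction_def by simp
  then show ?thesis
    by (simp only: right_diff_distrib mult.assoc)
qed

lemma normal_direction_neutral:
  "\<sigma> z = z \<Longrightarrow> normal_direction A \<sigma> \<kappa> K \<nu> $ z = 0"
  by (simp add: normal_direction_eq)

lemma orbit_coeff_eq:
  "orbit_coeff A \<sigma> \<kappa> K rep \<nu> \<omega> = C_star K *
    (sqrt (\<kappa> (\<sigma> (rep \<omega>))) * A $ \<nu> $ rep \<omega> - sqrt (\<kappa> (rep \<omega>)) * A $ \<nu> $ \<sigma> (rep \<omega>))"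
  using weight_pos[of "rep \<omega>"] by (simp add: orbit_coeff_def normal_direction_eq)

lemma normal_direction_decomposition:
  "normal_direction A \<sigma> \<kappa> K \<nu> =
    (\<Sum>\<omega>\<in>pair_orbits \<sigma>. orbit_coeff A \<sigma> \<kappa> K rep \<nu> \<omega> *\<^sub>R orbit_director \<sigma> \<kappa> rep \<omega>)"
  (is "_ = ?S")
proof (rule vec_eq_iff[THEN iffD2], rule allI)
  fix z
  show "normal_direction A \<sigma> \<kappa> K \<nu> $ z = ?S $ z"
  proof (cases "\<sigma> z = z")
    case True
    then have "z \<notin> \<omega>" if "\<omega> \<in> pair_orbits \<sigma>" for \<omega>
      using that pair_orbits_eq(2) by blast
    then show ?thesis
      using True by (simp add: normal_direction_neutral orbit_director_support)
  next
    case False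
    then have \<omega>: "{z, \<sigma> z} \<in> pair_orbits \<sigma>" by (auto simp: pair_orbits_def)
    then consider "rep {z, \<sigma> z} = z" | "rep {z, \<sigma> z} = \<sigma> z" using rep by blast
    \<comment> \<open>If the representative is \<open>\<sigma> z\<close>, the negative entry of the
      director at \<open>z\<close> compensates the sign change of the bracket in
      \<open>normal_direction_eq\<close>.\<close>
    then have "normal_direction A \<sigma> \<kappa> K \<nu> $ z =
        orbit_coeff A \<sigma> \<kappa> K rep \<nu> {z, \<sigma> z} * orbit_director \<sigma> \<kappa> rep {z, \<sigma> z} $ z"
      using False
      by cases (simp_all add: normal_direction_eq orbit_coeff_eq orbit_director_def
          involution' algebra_simps)
    also have "\<dots> = ?S $ z"
      using \<omega> by (rule orbit_director_sum_component[symmetric]) simp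
    finally show ?thesis .
  qed
qed

text \<open>Passing to \<open>\<kappa> \<circ> \<sigma>\<close> exchanges the two square roots in
  the director, which turns its entries into the factors of the entries of \<open>A\<close> in
  \<open>orbit_coeff_eq\<close>.\<close>

lemma orbit_coeff_column:
  assumes "\<omega> \<in> pair_orbits \<sigma>"
  shows "(\<chi> \<nu>. orbit_coeff A \<sigma> \<kappa> K rep \<nu> \<omega>) =
    C_star K *\<^sub>R (A *v orbit_director \<sigma> (\<kappa> \<circ> \<sigma>) rep \<omega>)"
proof -
  let ?r = "rep \<omega>"
  have ne: "\<sigma> ?r \<noteq> ?r" using pair_orbits_eq(2)[OF assms rep[OF assms]] .
  have "(A *v orbit_director \<sigma> (\<kappa> \<circ> \<sigma>) rep \<omega>) $ \<nu> =
      (\<Sum>z\<in>{?r, \<sigma> ?r}. A $ \<nu> $ z * orbit_director \<sigma> (\<kappa> \<circ> \<sigma>) rep \<omega> $ z)" for \<nu>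
    unfolding matrix_vector_mult_def vec_lambda_beta
    by (rule sum.mono_neutral_cong_right) (auto simp: orbit_director_def)
  then have "(A *v orbit_director \<sigma> (\<kappa> \<circ> \<sigma>) rep \<omega>) $ \<nu> =
      sqrt (\<kappa> (\<sigma> ?r)) * A $ \<nu> $ ?r - sqrt (\<kappa> ?r) * A $ \<nu> $ \<sigma> ?r" for \<nu>
    using ne ne[symmetric] by (simp add: orbit_director_def involution')
  then show ?thesis
    by (simp add: vec_eq_iff orbit_coeff_eq)
qed

text \<open>Since \<open>A\<close> is injective, a relation between columns pulls back to one
  between directors for the weights \<open>\<kappa> \<circ> \<sigma>\<close>. Both the rank and the
  computation of the response span rest on this.\<close>

lemma orbit_coeff_columns_zero:
  assumes "(\<Sum>\<omega>\<in>pair_orbits \<sigma>. a \<omega> *\<^sub>R (\<chi> \<nu>. orbit_coeff A \<sigma> \<kappa> K rep \<nu> \<omega>)) = 0"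
  shows "\<forall>\<omega>\<in>pair_orbits \<sigma>. a \<omega> = 0"
proof -
  let ?y = "\<Sum>\<omega>\<in>pair_orbits \<sigma>. a \<omega> *\<^sub>R orbit_director \<sigma> (\<kappa> \<circ> \<sigma>) rep \<omega>"
  have "C_star K *\<^sub>R (A *v ?y) =
      (\<Sum>\<omega>\<in>pair_orbits \<sigma>. a \<omega> *\<^sub>R (\<chi> \<nu>. orbit_coeff A \<sigma> \<kappa> K rep \<nu> \<omega>))"
    by (simp add: orbit_coeff_column linear_sum[OF matrix_vector_mul_linear] scaleR_sum_right
        matrix_vector_mult_scaleR mult.commute cong: sum.cong)
  then have "A *v ?y = 0" using assms C_star_pos by simp
  moreover have "inj ((*v) A)" using full_column_rank by (simp add: full_rank_injective)
  ultimately have "?y = 0"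
    using injD[of "(*v) A" ?y 0] by simp
  then show ?thesis
    using orbit_directors_zero[of "\<kappa> \<circ> \<sigma>"] weight_pos by simp
qed

text \<open>The rank is the dimension of a set, so the columns must be pairwise distinct as well as
  independent; \<open>independent_family\<close> supplies both.\<close>

lemma column_rank_orbit_coeff:
  "column_rank_on (pair_orbits \<sigma>) (orbit_coeff A \<sigma> \<kappa> K rep) = n_pair \<sigma>"
  using independent_family[where v = "\<lambda>\<omega>. \<chi> \<nu>. orbit_coeff A \<sigma> \<kappa> K rep \<nu> \<omega>",
      OF finite_pair_orbits orbit_coeff_columns_zero]
  by (simp add: column_rank_on_def n_pair_def dim_eq_card_independent card_image)

lemma orbit_coeff_nonzero:
  assumes "\<omega> \<in> pair_orbits \<sigma>"
  shows "\<exists>\<nu>. orbit_coeff A \<sigma> \<kappa> K rep \<nu> \<omega> \<noteq> 0"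
proof (rule ccontr)
  assume "\<nexists>\<nu>. orbit_coeff A \<sigma> \<kappa> K rep \<nu> \<omega> \<noteq> 0"
  then have "(\<chi> \<nu>. orbit_coeff A \<sigma> \<kappa> K rep \<nu> \<omega>) = 0" by (simp add: vec_eq_iff)
  \<comment> \<open>A zero column would give a relation whose coefficients are the indicator of
    \<open>\<omega>\<close>.\<close>
  then have "(\<Sum>\<omega>'\<in>pair_orbits \<sigma>.
      (if \<omega>' = \<omega> then 1 else 0 :: real) *\<^sub>R (\<chi> \<nu>. orbit_coeff A \<sigma> \<kappa> K rep \<nu> \<omega>')) = 0"
    by (intro sum.neutral) simp
  from orbit_coeff_columns_zero[OF this] show False
    using assms by auto
qed

section \<open>The orientation field and the response span\<close>

lemma orientation_field_normal:
  "orientation_field f A \<sigma> \<kappa> K \<gamma> = (\<Sum>\<nu>\<in>UNIV. f \<nu> \<gamma> *\<^sub>R normal_direction A \<sigma> \<kappa> K \<nu>)"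
proof (rule vec_eq_iff[THEN iffD2], rule allI)
  fix z
  have "orientation_field f A \<sigma> \<kappa> K \<gamma> $ z = (\<Sum>\<nu>\<in>UNIV. f \<nu> \<gamma> * A $ \<nu> $ z -
      C_star K * (f \<nu> \<gamma> * (A $ \<nu> $ z + \<kappa> z * A $ \<nu> $ \<sigma> z)))"
    by (simp add: orientation_field_def u_fun_def s_fun_def B_coeff_def sum_subtractf
        sum_distrib_left)
  also have "\<dots> = (\<Sum>\<nu>\<in>UNIV. f \<nu> \<gamma> * normal_direction A \<sigma> \<kappa> K \<nu> $ z)"
    by (intro sum.cong) (simp_all add: normal_direction_def algebra_simps)
  finally show "orientation_field f A \<sigma> \<kappa> K \<gamma> $ z =
      (\<Sum>\<nu>\<in>UNIV. f \<nu> \<gamma> *\<^sub>R normal_direction A \<sigma> \<kappa> K \<nu>) $ z"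
    by simp
qed

lemma orientation_field_decomposition:
  "orientation_field f A \<sigma> \<kappa> K \<gamma> =
    (\<Sum>\<omega>\<in>pair_orbits \<sigma>. orbit_profile f A \<sigma> \<kappa> K rep \<omega> \<gamma> *\<^sub>R orbit_director \<sigma> \<kappa> rep \<omega>)"
  unfolding orientation_field_normal normal_direction_decomposition orbit_profile_def
    scaleR_sum_right scaleR_sum_left
  by (subst sum.swap) simp

text \<open>One inclusion is the decomposition of the field. The other is tested against orthogonal
  vectors, which avoids choosing sample points \<open>\<gamma>\<close> at which the values of the
  \<open>f \<nu>\<close> form an invertible matrix.\<close>

lemma response_span_eq:
  "response_span f A \<sigma> \<kappa> K = span (orbit_director \<sigma> \<kappa> rep ` pair_orbits \<sigma>)"
  unfolding response_span_def
proof (rule span_eq[THEN iffD2], intro conjI image_subsetI)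
  show "orientation_field f A \<sigma> \<kappa> K \<gamma> \<in> span (orbit_director \<sigma> \<kappa> rep ` pair_orbits \<sigma>)" for \<gamma>
    unfolding orientation_field_decomposition
    by (intro span_sum span_scale span_base imageI)
next
  fix \<omega> assume \<omega>: "\<omega> \<in> pair_orbits \<sigma>"
  show "orbit_director \<sigma> \<kappa> rep \<omega> \<in> span (orientation_field f A \<sigma> \<kappa> K ` {0<..<1})"
  proof (rule in_span_if_orthogonal)
    fix y
    assume y: "\<And>x. x \<in> orientation_field f A \<sigma> \<kappa> K ` {0<..<1} \<Longrightarrow> y \<bullet> x = 0"
    \<comment> \<open>Orthogonality to the field is a linear relation between the functions
      \<open>f \<nu>\<close> on the whole interval, with coefficients independent of
      \<open>\<gamma>\<close>.\<close>
    have "(\<Sum>\<nu>\<in>UNIV. (y \<bullet> normal_direction A \<sigma> \<kappa> K \<nu>) * f \<nu> \<gamma>) = 0" if "\<gamma> \<in> {0<..<1}" for \<gamma>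
      using y[OF imageI[OF that]]
      by (simp add: orientation_field_normal inner_sum_right mult.commute)
    then have "y \<bullet> normal_direction A \<sigma> \<kappa> K \<nu> = 0" for \<nu>
      using lin_indep[unfolded lin_indep_functions_on_def, rule_format,
          of "\<lambda>\<nu>. y \<bullet> normal_direction A \<sigma> \<kappa> K \<nu>"] by blast
    \<comment> \<open>Inserting the decomposition of the normal directions, the products of
      \<open>y\<close> with the directors become the coefficients of a relation between the columns,
      read off row by row.\<close>
    then have "(\<Sum>\<omega>\<in>pair_orbits \<sigma>.
        (y \<bullet> orbit_director \<sigma> \<kappa> rep \<omega>) * orbit_coeff A \<sigma> \<kappa> K rep \<nu> \<omega>) = 0" for \<nu>
      unfolding normal_direction_decomposition inner_sum_right inner_scaleR_right
      by (simp only: mult.commute)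
    then have "(\<Sum>\<omega>\<in>pair_orbits \<sigma>. (y \<bullet> orbit_director \<sigma> \<kappa> rep \<omega>) *\<^sub>R
        (\<chi> \<nu>. orbit_coeff A \<sigma> \<kappa> K rep \<nu> \<omega>)) = 0"
      unfolding vec_eq_iff by simp
    from orbit_coeff_columns_zero[OF this] \<omega>
    show "y \<bullet> orbit_director \<sigma> \<kappa> rep \<omega> = 0" by simp
  qed
qed

lemma response_span_direct_sum:
  "internal_direct_sum (pair_orbits \<sigma>) (\<lambda>\<omega>. span {orbit_director \<sigma> \<kappa> rep \<omega>})
    (response_span f A \<sigma> \<kappa> K)"
  unfolding response_span_eq
  by (rule internal_direct_sum_lines[OF finite_pair_orbits orbit_directors_zero[OF weight_pos]])

lemma dim_response_span: "dim (response_span f A \<sigma> \<kappa> K) = n_pair \<sigma>"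
  using independent_family[where v = "orbit_director \<sigma> \<kappa> rep",
      OF finite_pair_orbits orbit_directors_zero[OF weight_pos]]
  by (simp add: response_span_eq n_pair_def dim_eq_card_independent card_image)

end

theorem theorem4p4:
  fixes f :: "'n::finite \<Rightarrow> real \<Rightarrow> real"
    and A :: "real ^ 'z::finite ^ 'n"
    and \<sigma> :: "'z \<Rightarrow> 'z"
    and \<kappa> :: "'z \<Rightarrow> real"
    and K :: real
    and C :: "real ^ 'z \<Rightarrow> real \<Rightarrow> real"
    and rep :: "'z set \<Rightarrow> 'z"
  assumes data: "spectral_duality_data f A \<sigma> \<kappa> K"
    and C: "\<And>p \<gamma>. \<lbrakk>p \<in> prob_simplex; \<gamma> \<in> {0<..<1}\<rbrakk> \<Longrightarrow> C p \<gamma> = response f A \<sigma> \<kappa> p \<gamma>"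
    and rep: "\<And>\<omega>. \<omega> \<in> pair_orbits \<sigma> \<Longrightarrow> rep \<omega> \<in> \<omega>"
  shows
    "((\<forall>\<nu>. normal_direction A \<sigma> \<kappa> K \<nu> =
          (\<Sum>\<omega>\<in>pair_orbits \<sigma>. orbit_coeff A \<sigma> \<kappa> K rep \<nu> \<omega> *\<^sub>R orbit_director \<sigma> \<kappa> rep \<omega>)) \<and>
      (\<forall>\<omega>\<in>pair_orbits \<sigma>. {z. orbit_director \<sigma> \<kappa> rep \<omega> $ z \<noteq> 0} \<subseteq> \<omega>) \<and>
      (\<forall>\<nu> z. \<sigma> z = z \<longrightarrow> normal_direction A \<sigma> \<kappa> K \<nu> $ z = 0)) \<and>
     (column_rank_on (pair_orbits \<sigma>) (orbit_coeff A \<sigma> \<kappa> K rep) = n_pair \<sigma> \<and>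
      (\<forall>\<omega>\<in>pair_orbits \<sigma>. \<exists>\<nu>. orbit_coeff A \<sigma> \<kappa> K rep \<nu> \<omega> \<noteq> 0)) \<and>
     (internal_direct_sum (pair_orbits \<sigma>) (\<lambda>\<omega>. span {orbit_director \<sigma> \<kappa> rep \<omega>})
        (response_span f A \<sigma> \<kappa> K) \<and>
      dim (response_span f A \<sigma> \<kappa> K) = n_pair \<sigma> \<and>
      (\<forall>\<gamma>\<in>{0<..<1}. orientation_field f A \<sigma> \<kappa> K \<gamma> =
          (\<Sum>\<omega>\<in>pair_orbits \<sigma>. orbit_profile f A \<sigma> \<kappa> K rep \<omega> \<gamma> *\<^sub>R orbit_director \<sigma> \<kappa> rep \<omega>)))"
proof -
  interpret spectral_duality_data f A \<sigma> \<kappa> K by (fact data)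
  interpret represented_spectral_duality_data f A \<sigma> \<kappa> K rep
    by unfold_locales (use involution rep in auto)
  show ?thesis
    \<comment> \<open>The support inclusion in (i) is the contrapositive of
      \<open>orbit_director_support\<close>.\<close>
    using normal_direction_decomposition orbit_director_support normal_direction_neutral
      column_rank_orbit_coeff orbit_coeff_nonzero response_span_direct_sum dim_response_span
      orientation_field_decomposition
    by blast
qed

end
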